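(* Let $\sigma=\{E,\mathsf{orange},\mathsf{blue}\}$ with $E$ a binary and $\mathsf{orange},\mathsf{blue}$ unary relation symbols, and let $$\varphi(x):=\exists y\,\Big(\mathsf{orange}(y)\wedge\neg\exists z\,\big(E(x,z)\wedge E(z,y)\big)\wedge\neg\exists z\,\big(\mathsf{blue}(z)\wedge E(y,z)\big)\Big),$$ a first-order formula of quantifier rank $2$. Then $\varphi(x)$ is not equivalent (over finite $\sigma$-structures) to any formula $\varphi'(x)$ that is a Boolean combination of local first-order formulas of quantifier rank at most $2$ and of basic local sentences.
   Context: All structures are finite with non-empty universe. The Gaifman graph of a $\sigma$-structure $\mathcal A$ has as vertices the elements of the universe $A$ and an edge between distinct $a,b$ iff both occur in a common tuple of some relation of $\mathcal A$; $\mathrm{dist}^{\mathcal A}$ is the distance in this graph ($\infty$ if disconnected). For a non-empty tuple $\bar a$, $\mathcal N_r^{\mathcal A}(\bar a)$ is the induced substructure on the set of all elements at distance at most $r$ from some entry of $\bar a$. A first-order formula $\psi$ is $r$-local if for some non-empty tuple $\bar x$ of variables containing all free variables of $\psi$, all structures $\mathcal A$ and all $\bar a\in A^{|\bar x|}$: $\mathcal A\models\psi(\bar a)\iff\mathcal N_r^{\mathcal A}(\bar a)\models\psi(\bar a)$. It is local if it is $r$-local for some $r\in\mathbb N$. For $m\in\mathbb N$, $\mathrm{dist}(x,y)>m$ denotes a first-order formula expressing that the distance of $x$ and $y$ is greater than $m$. A basic local sentence is a first-order sentence of the form $\exists y_1\cdots\exists y_\ell\big(\bigwedge_{1\le i<j\le\ell}\mathrm{dist}(y_i,y_j)>2r\wedge\bigwedge_{1\le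 j\le\ell}\lambda(y_j)\big)$ with $\ell\ge1$, $r\ge0$, and $\lambda(y)$ an $r$-local first-order formula (of arbitrary quantifier rank) with only one free variable. The quantifier rank is the maximum nesting depth of quantifiers. *)

theory Defs
  imports Main "HOL-Library.Extended_Nat"
begin

(* First-order logic with equality over relational signatures. A signature is a type 'r of
   relation symbols together with an arity function. Disjunction, implication and universal
   quantification are the usual derived operations; they do not affect the quantifier rank. *)

datatype ('r, 'v) fm =
    Eq 'v 'v
  | Rel 'r "'v list"
  | Neg "('r, 'v) fm"
  | And "('r, 'v) fm" "('r, 'v) fm"
  | Ex 'v "('r, 'v) fm"

type_synonym 'r formula = "('r, nat) fm"

primrec wf_fm :: "('r \<Rightarrow> nat) \<Rightarrow> 'r formula \<Rightarrow> bool" where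
  "wf_fm ar (Eq x y) \<longleftrightarrow> True"
| "wf_fm ar (Rel R xs) \<longleftrightarrow> length xs = ar R"
| "wf_fm ar (Neg \<phi>) \<longleftrightarrow> wf_fm ar \<phi>"
| "wf_fm ar (And \<phi> \<psi>) \<longleftrightarrow> wf_fm ar \<phi> \<and> wf_fm ar \<psi>"
| "wf_fm ar (Ex x \<phi>) \<longleftrightarrow> wf_fm ar \<phi>"

primrec fv :: "'r formula \<Rightarrow> nat set" where
  "fv (Eq x y) = {x, y}"
| "fv (Rel R xs) = set xs"
| "fv (Neg \<phi>) = fv \<phi>"
| "fv (And \<phi> \<psi>) = fv \<phi> \<union> fv \<psi>"
| "fv (Ex x \<phi>) = fv \<phi> - {x}"

primrec qrank :: "'r formula \<Rightarrow> nat" where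
  "qrank (Eq x y) = 0"
| "qrank (Rel R xs) = 0"
| "qrank (Neg \<phi>) = qrank \<phi>"
| "qrank (And \<phi> \<psi>) = max (qrank \<phi>) (qrank \<psi>)"
| "qrank (Ex x \<phi>) = Suc (qrank \<phi>)"

record ('r, 'a) struct =
  univ :: "'a set"
  interp :: "'r \<Rightarrow> 'a list set"

definition is_structure :: "('r \<Rightarrow> nat) \<Rightarrow> ('r, 'a) struct \<Rightarrow> bool" where
  "is_structure ar A \<longleftrightarrow> finite (univ A) \<and> univ A \<noteq> {} \<and>
     (\<forall>R. interp A R \<subseteq> {t. length t = ar R \<and> set t \<subseteq> univ A})"

primrec sat :: "('r, 'a) struct \<Rightarrow> (nat \<Rightarrow> 'a) \<Rightarrow> 'r formula \<Rightarrow> bool" where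
  "sat A v (Eq x y) \<longleftrightarrow> v x = v y"
| "sat A v (Rel R xs) \<longleftrightarrow> map v xs \<in> interp A R"
| "sat A v (Neg \<phi>) \<longleftrightarrow> \<not> sat A v \<phi>"
| "sat A v (And \<phi> \<psi>) \<longleftrightarrow> sat A v \<phi> \<and> sat A v \<psi>"
| "sat A v (Ex x \<phi>) \<longleftrightarrow> (\<exists>a\<in>univ A. sat A (v(x := a)) \<phi>)"

definition gaifman :: "('r, 'a) struct \<Rightarrow> 'a rel" where
  "gaifman A = {(a, b). a \<noteq> b \<and> (\<exists>R. \<exists>t\<in>interp A R. a \<in> set t \<and> b \<in> set t)}"

definition gdist :: "('r, 'a) struct \<Rightarrow> 'a \<Rightarrow> 'a \<Rightarrow> enat" where
  "gdist A a b = (INF n\<in>{n. (a, b) \<in> gaifman A ^^ n}. enat n)"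

definition induced :: "('r, 'a) struct \<Rightarrow> 'a set \<Rightarrow> ('r, 'a) struct" where
  "induced A B = \<lparr>univ = B, interp = (\<lambda>R. {t \<in> interp A R. set t \<subseteq> B})\<rparr>"

definition nbhd :: "('r, 'a) struct \<Rightarrow> nat \<Rightarrow> 'a list \<Rightarrow> ('r, 'a) struct" where
  "nbhd A r as = induced A {b \<in> univ A. \<exists>a\<in>set as. gdist A a b \<le> enat r}"

(* From here on, "all structures" means all structures whose universe is a finite non-empty
   set of naturals; up to isomorphism these are all finite structures. A tuple of elements
   assigned to the tuple xs of variables is given by a valuation v, as map v xs. *)

definition r_local :: "('r \<Rightarrow> nat) \<Rightarrow> nat \<Rightarrow> 'r formula \<Rightarrow> bool" where
  "r_local ar r \<psi> \<longleftrightarrow> wf_fm ar \<psi> \<and>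
     (\<exists>xs. xs \<noteq> [] \<and> fv \<psi> \<subseteq> set xs \<and>
        (\<forall>(A :: ('r, nat) struct) v. is_structure ar A \<and> v ` set xs \<subseteq> univ A \<longrightarrow>
           (sat A v \<psi> \<longleftrightarrow> sat (nbhd A r (map v xs)) v \<psi>)))"

definition is_local :: "('r \<Rightarrow> nat) \<Rightarrow> 'r formula \<Rightarrow> bool" where
  "is_local ar \<psi> \<longleftrightarrow> (\<exists>r. r_local ar r \<psi>)"

definition expresses_dist_gt :: "('r \<Rightarrow> nat) \<Rightarrow> nat \<Rightarrow> nat \<Rightarrow> nat \<Rightarrow> 'r formula \<Rightarrow> bool" where
  "expresses_dist_gt ar m x y \<delta> \<longleftrightarrow> wf_fm ar \<delta> \<and> fv \<delta> \<subseteq> {x, y} \<and>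
     (\<forall>(A :: ('r, nat) struct) v. is_structure ar A \<and> v x \<in> univ A \<and> v y \<in> univ A \<longrightarrow>
        (sat A v \<delta> \<longleftrightarrow> gdist A (v x) (v y) > enat m))"

(* Only used for non-empty lists. *)
fun big_and :: "'r formula list \<Rightarrow> 'r formula" where
  "big_and [\<phi>] = \<phi>"
| "big_and (\<phi> # \<psi> # \<phi>s) = And \<phi> (big_and (\<psi> # \<phi>s))"

(* Passing from \<lambda>(y) to \<lambda>(z): the names y and z are exchanged everywhere, in bound positions
   as well, so that no variable is captured. As intended if z = y or z is not free. *)
definition rename :: "nat \<Rightarrow> nat \<Rightarrow> 'r formula \<Rightarrow> 'r formula" where
  "rename y z = map_fm id (id(y := z, z := y))"

(* \<delta> i j may be any formula expressing the distance condition. *)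
definition basic_local_sentence :: "('r \<Rightarrow> nat) \<Rightarrow> 'r formula \<Rightarrow> bool" where
  "basic_local_sentence ar \<chi> \<longleftrightarrow>
     (\<exists>ys r y lam \<delta>. ys \<noteq> [] \<and> distinct ys \<and>
        r_local ar r lam \<and> fv lam \<subseteq> {y} \<and>
        (\<forall>j<length ys. \<forall>i<j. expresses_dist_gt ar (2 * r) (ys ! i) (ys ! j) (\<delta> i j)) \<and>
        \<chi> = foldr Ex ys (big_and
              ([\<delta> i j. j \<leftarrow> [0..<length ys], i \<leftarrow> [0..<j]] @ map (\<lambda>z. rename y z lam) ys)))"

inductive bool_comb :: "('r formula \<Rightarrow> bool) \<Rightarrow> 'r formula \<Rightarrow> bool" for P where
  base: "P \<phi> \<Longrightarrow> bool_comb P \<phi>"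
| neg: "bool_comb P \<phi> \<Longrightarrow> bool_comb P (Neg \<phi>)"
| conj: "bool_comb P \<phi> \<Longrightarrow> bool_comb P \<psi> \<Longrightarrow> bool_comb P (And \<phi> \<psi>)"

definition equivalent :: "('r \<Rightarrow> nat) \<Rightarrow> 'r formula \<Rightarrow> 'r formula \<Rightarrow> bool" where
  "equivalent ar \<phi> \<psi> \<longleftrightarrow>
     (\<forall>(A :: ('r, nat) struct) v. is_structure ar A \<and> v ` (fv \<phi> \<union> fv \<psi>) \<subseteq> univ A \<longrightarrow>
        (sat A v \<phi> \<longleftrightarrow> sat A v \<psi>))"

datatype sigma = E | Orange | Blue

primrec sigma_ar :: "sigma \<Rightarrow> nat" where
  "sigma_ar E = 2"
| "sigma_ar Orange = 1"
| "sigma_ar Blue = 1"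

definition phi :: "nat \<Rightarrow> nat \<Rightarrow> nat \<Rightarrow> sigma formula" where
  "phi x y z = Ex y (And (Rel Orange [y]) (And
      (Neg (Ex z (And (Rel E [x, z]) (Rel E [z, y]))))
      (Neg (Ex z (And (Rel Blue [z]) (Rel E [y, z]))))))"

lemma wf_phi: "wf_fm sigma_ar (phi x y z)"
  by (simp add: phi_def)

lemma qrank_phi: "qrank (phi x y z) = 2"
  by (simp add: phi_def)

lemma fv_phi: "distinct [x, y, z] \<Longrightarrow> fv (phi x y z) = {x}"
  by (auto simp: phi_def)

lemma fv_rename: "fv (rename y z \<phi>) = (id(y := z, z := y)) ` fv \<phi>"
proof -
  define f where "f = id(y := z, z := y)"
  have inj: "f u = f w \<longleftrightarrow> u = w" for u w
    by (auto simp: f_def)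
  have "fv (map_fm id f \<phi>) = f ` fv \<phi>"
    by (induction \<phi>) (auto simp: inj)
  then show ?thesis
    by (simp add: rename_def f_def)
qed

lemma sat_rename: "sat A v (rename y z \<phi>) \<longleftrightarrow> sat A (v \<circ> id(y := z, z := y)) \<phi>"
proof -
  define f where "f = id(y := z, z := y)"
  have inj: "f u = f w \<longleftrightarrow> u = w" for u w
    by (auto simp: f_def)
  have "sat A v (map_fm id f \<phi>) \<longleftrightarrow> sat A (v \<circ> f) \<phi>"
  proof (induction \<phi> arbitrary: v)
    case (Ex x \<phi>)
    have "v(f x := a) \<circ> f = (v \<circ> f)(x := a)" for a
      by (simp add: fun_eq_iff inj)
    with Ex show ?case
      by (simp only: fm.map sat.simps)
  qed simp_all
  then show ?thesis
    by (simp add: rename_def f_def)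
qed

(* The distance conditions are first-order expressible over the signature at hand. *)

lemma gaifman_sigma:
  assumes "is_structure sigma_ar A"
  shows "(a, b) \<in> gaifman A \<longleftrightarrow> a \<noteq> b \<and> ([a, b] \<in> interp A E \<or> [b, a] \<in> interp A E)"
proof
  assume "(a, b) \<in> gaifman A"
  then obtain R t where *: "a \<noteq> b" "t \<in> interp A R" "a \<in> set t" "b \<in> set t"
    by (auto simp: gaifman_def)
  with assms have "length t = sigma_ar R"
    unfolding is_structure_def by blast
  with * show "a \<noteq> b \<and> ([a, b] \<in> interp A E \<or> [b, a] \<in> interp A E)"
    by (cases R) (auto simp: length_Suc_conv numeral_2_eq_2)
next
  assume *: "a \<noteq> b \<and> ([a, b] \<in> interp A E \<or> [b, a] \<in> interp A E)"
  then show "(a, b) \<in> gaifman A"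
    unfolding gaifman_def by force
qed

lemma gdist_le_iff: "gdist A a b \<le> enat m \<longleftrightarrow> (\<exists>n\<le>m. (a, b) \<in> gaifman A ^^ n)"
proof
  assume le: "gdist A a b \<le> enat m"
  let ?S = "{n. (a, b) \<in> gaifman A ^^ n}"
  have ne: "?S \<noteq> {}"
  proof
    assume "?S = {}"
    then have "gdist A a b = \<infinity>"
      unfolding gdist_def by (simp only: image_empty Inf_enat_def) simp
    with le show False by simp
  qed
  then have "Inf (enat ` ?S) \<in> enat ` ?S"
    by (simp add: Inf_enat_def) (metis (mono_tags, lifting) LeastI image_eqI mem_Collect_eq)
  with le show "\<exists>n\<le>m. (a, b) \<in> gaifman A ^^ n"
    by (auto simp: gdist_def)
next
  assume "\<exists>n\<le>m. (a, b) \<in> gaifman A ^^ n"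
  then show "gdist A a b \<le> enat m"
    unfolding gdist_def by (meson INF_lower2 enat_ord_simps(1) mem_Collect_eq)
qed

lemma dist_gt_expressible: "\<exists>\<delta>. expresses_dist_gt sigma_ar m x y \<delta>"
proof -
  have "\<exists>\<delta>. wf_fm sigma_ar \<delta> \<and> fv \<delta> \<subseteq> {x, y} \<and>
     (\<forall>(A :: (sigma, nat) struct) v. is_structure sigma_ar A \<and> v x \<in> univ A \<and> v y \<in> univ A \<longrightarrow>
        (sat A v \<delta> \<longleftrightarrow> (\<exists>n\<le>m. (v x, v y) \<in> gaifman A ^^ n)))"
  proof (induction m arbitrary: x)
    case 0
    show ?case by (rule exI[of _ "Eq x y"]) auto
  next
    case (Suc m)
    obtain z where z: "z \<noteq> x" "z \<noteq> y"
      using that[of "Suc (x + y)"] by auto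
    obtain \<delta> where \<delta>: "wf_fm sigma_ar \<delta>" "fv \<delta> \<subseteq> {z, y}"
      "\<And>(A :: (sigma, nat) struct) v. is_structure sigma_ar A \<Longrightarrow> v z \<in> univ A \<Longrightarrow> v y \<in> univ A \<Longrightarrow>
        (sat A v \<delta> \<longleftrightarrow> (\<exists>n\<le>m. (v z, v y) \<in> gaifman A ^^ n))"
      using Suc[of z] by blast
    let ?\<epsilon> = "Ex z (And (Neg (And (Neg (Eq x z))
      (And (Neg (Rel E [x, z])) (Neg (Rel E [z, x]))))) \<delta>)"
    have "sat A v ?\<epsilon> \<longleftrightarrow> (\<exists>n\<le>Suc m. (v x, v y) \<in> gaifman A ^^ n)"
      if A: "is_structure sigma_ar A" "v x \<in> univ A" "v y \<in> univ A"
      for A :: "(sigma, nat) struct" and v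
    proof -
      have "sat A v ?\<epsilon> \<longleftrightarrow> (\<exists>a\<in>univ A. (v x = a \<or> (v x, a) \<in> gaifman A) \<and>
          (\<exists>n\<le>m. (a, v y) \<in> gaifman A ^^ n))"
      proof -
        have "sat A (v(z := a)) \<delta> \<longleftrightarrow> (\<exists>n\<le>m. (a, v y) \<in> gaifman A ^^ n)" if "a \<in> univ A" for a
          using \<delta>(3)[of A "v(z := a)"] A that z by simp
        moreover have "v x = a \<or> (v x, a) \<in> gaifman A \<longleftrightarrow>
            v x = a \<or> [v x, a] \<in> interp A E \<or> [a, v x] \<in> interp A E" for a
          using gaifman_sigma[OF A(1)] by blast
        ultimately show ?thesis
          using z by simp
      qed
      also have "\<dots> \<longleftrightarrow> (\<exists>n\<le>Suc m. (v x, v y) \<in> gaifman A ^^ n)"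
      proof
        assume "\<exists>a\<in>univ A. (v x = a \<or> (v x, a) \<in> gaifman A) \<and>
          (\<exists>n\<le>m. (a, v y) \<in> gaifman A ^^ n)"
        then obtain a n where n: "v x = a \<or> (v x, a) \<in> gaifman A" "n \<le> m"
            "(a, v y) \<in> gaifman A ^^ n"
          by blast
        then have "(v x, v y) \<in> gaifman A ^^ n \<or> (v x, v y) \<in> gaifman A ^^ Suc n"
          by (auto simp del: relpow.simps intro: relpow_Suc_I2)
        then show "\<exists>n\<le>Suc m. (v x, v y) \<in> gaifman A ^^ n"
          using n(2) by (metis Suc_le_mono le_SucI)
      next
        assume "\<exists>n\<le>Suc m. (v x, v y) \<in> gaifman A ^^ n"
        then obtain n where n: "n \<le> Suc m" "(v x, v y) \<in> gaifman A ^^ n" by blast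
        show "\<exists>a\<in>univ A. (v x = a \<or> (v x, a) \<in> gaifman A) \<and>
          (\<exists>n\<le>m. (a, v y) \<in> gaifman A ^^ n)"
        proof (cases n)
          case 0
          then show ?thesis using n A by (intro bexI[of _ "v x"]) auto
        next
          case (Suc k)
          then obtain a where a: "(v x, a) \<in> gaifman A" "(a, v y) \<in> gaifman A ^^ k"
            using n(2) relpow_Suc_D2[of "v x" "v y" k "gaifman A"] by auto
          have "a \<in> univ A"
            using a(1) A(1) unfolding gaifman_def is_structure_def by blast
          moreover have "k \<le> m" using n(1) Suc by simp
          ultimately show ?thesis using a by blast
        qed
      qed
      finally show ?thesis .
    qed
    then show ?case
    proof (intro exI[of _ ?\<epsilon>] conjI allI impI)
      show "wf_fm sigma_ar ?\<epsilon>" using \<delta>(1) by simp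
      show "fv ?\<epsilon> \<subseteq> {x, y}" using \<delta>(2) by auto
    qed blast
  qed
  then obtain \<delta> where \<delta>: "wf_fm sigma_ar \<delta>" "fv \<delta> \<subseteq> {x, y}"
    "\<And>(A :: (sigma, nat) struct) v. is_structure sigma_ar A \<Longrightarrow> v x \<in> univ A \<Longrightarrow> v y \<in> univ A \<Longrightarrow>
        (sat A v \<delta> \<longleftrightarrow> (\<exists>n\<le>m. (v x, v y) \<in> gaifman A ^^ n))"
    by blast
  have "gdist A a b > enat m \<longleftrightarrow> \<not> (\<exists>n\<le>m. (a, b) \<in> gaifman A ^^ n)"
    for A :: "(sigma, nat) struct" and a b
    using gdist_le_iff[of A a b m] not_le by blast
  then have "expresses_dist_gt sigma_ar m x y (Neg \<delta>)"
    using \<delta> by (simp add: expresses_dist_gt_def)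
  then show ?thesis by blast
qed

end

(* On constant assignments a local formula cannot tell a structure from its disjoint union with
   another one. In the disjoint union, spoiler's moves that are far from the distinguished element
   can be answered inside the added part, so a local formula of quantifier rank 2 only sees the
   elements at distance at most 2. In a structure with exactly two orange elements, both reachable
   from 3 by a directed path of length 2 but only one of them reachable in this way from 0, the
   elements 0 and 3 thus satisfy the same local formulas of rank 2, and they trivially satisfy
   the same sentences. *)
theory Submission imports Defs begin

section \<open>Ehrenfeucht-Fraisse games\<close>

text \<open>A position is a set of pairs, so neither the order of moves nor repeated moves matter.
  The first clause makes it an injective partial map; in the second, a list of pairs from
  \<open>p\<close> stands for two matching tuples.\<close>

definition partial_iso :: "('r, 'a) struct \<Rightarrow> ('r, 'b) struct \<Rightarrow> ('a \<times> 'b) set \<Rightarrow> bool" where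
  "partial_iso A B p \<longleftrightarrow>
     (\<forall>q\<in>p. \<forall>q'\<in>p. fst q = fst q' \<longleftrightarrow> snd q = snd q') \<and>
     (\<forall>R ts. set ts \<subseteq> p \<longrightarrow> (map fst ts \<in> interp A R \<longleftrightarrow> map snd ts \<in> interp B R))"

text \<open>Duplicator wins the \<open>n\<close>-round game from position \<open>p\<close>.\<close>

primrec back_forth ::
    "nat \<Rightarrow> ('r, 'a) struct \<Rightarrow> ('r, 'b) struct \<Rightarrow> ('a \<times> 'b) set \<Rightarrow> bool" where
  "back_forth 0 A B p \<longleftrightarrow> partial_iso A B p"
| "back_forth (Suc n) A B p \<longleftrightarrow> partial_iso A B p \<and>
     (\<forall>a\<in>univ A. \<exists>b\<in>univ B. back_forth n A B (insert (a, b) p)) \<and>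
     (\<forall>b\<in>univ B. \<exists>a\<in>univ A. back_forth n A B (insert (a, b) p))"

lemma back_forth_partial_iso: "back_forth n A B p \<Longrightarrow> partial_iso A B p"
  by (cases n) auto

text \<open>Only the values of free variables have to be matched by \<open>p\<close>, which may
  contain more. Hence when a quantifier rebinds \<open>x\<close>, the new pair is added and the pair
  of the old value can stay.\<close>

lemma back_forth_sat:
  assumes "back_forth n A B p" "qrank \<phi> \<le> n" "\<And>u. u \<in> fv \<phi> \<Longrightarrow> (v u, w u) \<in> p"
  shows "sat A v \<phi> \<longleftrightarrow> sat B w \<phi>"
  using assms
proof (induction \<phi> arbitrary: n p v w)
  case (Eq x y)
  then have "(v x, w x) \<in> p" "(v y, w y) \<in> p" by auto
  with back_forth_partial_iso[OF Eq.prems(1)] show ?case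
    unfolding partial_iso_def by (metis fst_conv snd_conv sat.simps(1))
next
  case (Rel R xs)
  let ?ts = "map (\<lambda>u. (v u, w u)) xs"
  have "set ?ts \<subseteq> p" using Rel.prems(3) by auto
  then have "map fst ?ts \<in> interp A R \<longleftrightarrow> map snd ?ts \<in> interp B R"
    using back_forth_partial_iso[OF Rel.prems(1)] unfolding partial_iso_def by blast
  then show ?case by (simp add: comp_def)
next
  case (Neg \<phi>)
  have "sat A v \<phi> \<longleftrightarrow> sat B w \<phi>"
    by (rule Neg.IH[OF Neg.prems(1)]) (use Neg.prems in auto)
  then show ?case by simp
next
  case (And \<phi> \<psi>)
  have "sat A v \<phi> \<longleftrightarrow> sat B w \<phi>"
    by (rule And.IH(1)[OF And.prems(1)]) (use And.prems in auto)
  moreover have "sat A v \<psi> \<longleftrightarrow> sat B w \<psi>"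
    by (rule And.IH(2)[OF And.prems(1)]) (use And.prems in auto)
  ultimately show ?case by simp
next
  case (Ex x \<phi>)
  from Ex.prems(2) obtain m where n: "n = Suc m" and m: "qrank \<phi> \<le> m"
    by (cases n) auto
  have step: "sat A (v(x := a)) \<phi> \<longleftrightarrow> sat B (w(x := b)) \<phi>"
    if "back_forth m A B (insert (a, b) p)" for a b
    by (rule Ex.IH[OF that m]) (use Ex.prems(3) in auto)
  show ?case
    using Ex.prems(1) step unfolding n back_forth.simps sat.simps by blast
qed

section \<open>Free variables of basic local sentences\<close>

lemma sat_cong:
  assumes "\<And>u. u \<in> fv \<phi> \<Longrightarrow> v u = w u"
  shows "sat A v \<phi> \<longleftrightarrow> sat A w \<phi>"
  using assms
proof (induction \<phi> arbitrary: v w)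
  case (Rel R xs)
  then have "map v xs = map w xs" by simp
  then show ?case by (simp only: sat.simps)
next
  case (Ex x \<phi>)
  have "sat A (v(x := a)) \<phi> \<longleftrightarrow> sat A (w(x := a)) \<phi>" for a
    by (rule Ex.IH) (use Ex.prems in auto)
  then show ?case by simp
next
  case (And \<phi> \<psi>)
  from And.IH(1)[of v w] And.IH(2)[of v w] And.prems show ?case by auto
next
  case (Neg \<phi>)
  from Neg.IH[of v w] Neg.prems show ?case by auto
qed auto

lemma fv_foldr_Ex: "fv (foldr Ex ys \<phi>) = fv \<phi> - set ys"
  by (induction ys) auto

lemma fv_big_and: "\<phi>s \<noteq> [] \<Longrightarrow> fv (big_and \<phi>s) = \<Union> (fv ` set \<phi>s)"
  by (induction \<phi>s rule: big_and.induct) auto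

lemma fv_basic_local_sentence:
  assumes "basic_local_sentence ar \<chi>"
  shows "fv \<chi> = {}"
proof -
  from assms obtain ys r y lam \<delta> where ys: "ys \<noteq> []" and lam: "fv lam \<subseteq> {y}"
    and \<delta>: "\<forall>j<length ys. \<forall>i<j. expresses_dist_gt ar (2 * r) (ys ! i) (ys ! j) (\<delta> i j)"
    and \<chi>: "\<chi> = foldr Ex ys (big_and
      ([\<delta> i j. j \<leftarrow> [0..<length ys], i \<leftarrow> [0..<j]] @ map (\<lambda>z. rename y z lam) ys))"
    unfolding basic_local_sentence_def by blast
  define \<psi>s where
    "\<psi>s = [\<delta> i j. j \<leftarrow> [0..<length ys], i \<leftarrow> [0..<j]] @ map (\<lambda>z. rename y z lam) ys"
  have "fv (\<delta> i j) \<subseteq> set ys" if "j < length ys" "i < j" for i j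
  proof -
    from that \<delta> have "fv (\<delta> i j) \<subseteq> {ys ! i, ys ! j}"
      unfolding expresses_dist_gt_def by blast
    then show ?thesis using that by (auto dest: subsetD)
  qed
  moreover have "fv (rename y z lam) \<subseteq> {z}" for z
    using lam by (auto simp: fv_rename)
  ultimately have "fv \<psi> \<subseteq> set ys" if "\<psi> \<in> set \<psi>s" for \<psi>
    using that unfolding \<psi>s_def by (auto; blast)
  moreover have "\<psi>s \<noteq> []"
    using ys by (simp add: \<psi>s_def)
  ultimately show ?thesis
    unfolding \<chi> \<psi>s_def[symmetric] fv_foldr_Ex by (auto simp: fv_big_and)
qed

section \<open>Local formulas and unions of components\<close>

lemma relpow_closed:
  assumes "r `` U \<subseteq> U" "a \<in> U" "(a, b) \<in> r ^^ n"
  shows "b \<in> U"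
  using assms(3)
proof (induction n arbitrary: b)
  case 0
  with assms(2) show ?case by simp
next
  case (Suc n)
  then obtain c where "(a, c) \<in> r ^^ n" "(c, b) \<in> r" by auto
  with Suc.IH assms(1) show ?case by blast
qed

text \<open>A path that starts in a closed set never leaves it, so the restriction loses no such
  path.\<close>

lemma relpow_Int_closed:
  assumes closed: "r `` U \<subseteq> U" and a: "a \<in> U"
  shows "(a, b) \<in> (r \<inter> U \<times> U) ^^ n \<longleftrightarrow> (a, b) \<in> r ^^ n"
proof (induction n arbitrary: b)
  case (Suc n)
  have "(c, b) \<in> r \<inter> U \<times> U \<longleftrightarrow> (c, b) \<in> r" if "(a, c) \<in> r ^^ n" for c
    using relpow_closed[OF closed a that] closed by blast
  with Suc.IH show ?case by (auto simp: relcomp_unfold)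
qed simp

text \<open>By \<open>comp\<close>, no tuple connects \<open>U\<close> with its complement.
  Distances from points of \<open>U\<close> are therefore the same in both structures, and balls
  around them stay inside \<open>U\<close>.\<close>

lemma nbhd_induced_component:
  assumes comp: "\<forall>R. \<forall>t\<in>interp D R. set t \<subseteq> U \<or> set t \<inter> U = {}"
    and U: "U \<subseteq> univ D" and as: "set as \<subseteq> U"
  shows "nbhd (induced D U) r as = nbhd D r as"
proof -
  have inside: "set t \<subseteq> U" if "t \<in> interp D R" "a \<in> set t" "a \<in> U" for R t a
    using comp that by blast
  have closed: "gaifman D `` U \<subseteq> U"
  proof
    fix b assume "b \<in> gaifman D `` U"
    then obtain a R t where "a \<in> U" "t \<in> interp D R" "a \<in> set t" "b \<in> set t"
      unfolding gaifman_def by blast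
    with inside[of t R a] show "b \<in> U" by blast
  qed
  have gaif: "gaifman (induced D U) = gaifman D \<inter> U \<times> U"
  proof (intro subset_antisym subrelI)
    fix a b assume "(a, b) \<in> gaifman (induced D U)"
    then show "(a, b) \<in> gaifman D \<inter> U \<times> U"
      unfolding gaifman_def induced_def by auto
  next
    fix a b assume ab: "(a, b) \<in> gaifman D \<inter> U \<times> U"
    then obtain R t where t: "a \<noteq> b" "t \<in> interp D R" "a \<in> set t" "b \<in> set t"
      unfolding gaifman_def by blast
    \<comment> \<open>A tuple witnessing an edge at a point of \<open>U\<close> lies wholly in
      \<open>U\<close> and so survives the restriction.\<close>
    with inside[of t R a] ab have "t \<in> interp (induced D U) R"
      by (simp add: induced_def)
    with t show "(a, b) \<in> gaifman (induced D U)"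
      unfolding gaifman_def by blast
  qed
  have gdist_closed: "b \<in> U" if "gdist D a b \<le> enat r" "a \<in> U" for a b
    using that relpow_closed[OF closed that(2)] unfolding gdist_le_iff by blast
  have le: "gdist (induced D U) a b \<le> enat r \<longleftrightarrow> gdist D a b \<le> enat r" if "a \<in> U" for a b
    unfolding gdist_le_iff gaif using relpow_Int_closed[OF closed that] by simp
  have "{b \<in> univ (induced D U). \<exists>a\<in>set as. gdist (induced D U) a b \<le> enat r} =
      {b \<in> univ D. \<exists>a\<in>set as. gdist D a b \<le> enat r}" (is "?N = ?M")
  proof -
    have "(\<exists>a\<in>set as. gdist (induced D U) a b \<le> enat r) \<longleftrightarrow> (\<exists>a\<in>set as. gdist D a b \<le> enat r)" for b
      using le as by (metis subsetD)
    moreover have "b \<in> U" if "\<exists>a\<in>set as. gdist D a b \<le> enat r" for b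
      using that gdist_closed as by blast
    ultimately show ?thesis
      using U by (simp add: induced_def) blast
  qed
  moreover have "?M \<subseteq> U"
    using gdist_closed as by blast
  ultimately show ?thesis
    unfolding nbhd_def by (simp add: induced_def) blast
qed

lemma is_structure_induced:
  assumes "is_structure ar D" "U \<subseteq> univ D" "U \<noteq> {}"
  shows "is_structure ar (induced D U)"
  using assms by (auto simp: is_structure_def induced_def intro: finite_subset)

text \<open>Both sides are decided in one and the same neighbourhood. The constant assignment keeps
  the whole tuple \<open>xs\<close> inside \<open>U\<close>, including its variables that are not
  free in \<open>\<psi>\<close>.\<close>

lemma is_local_component:
  fixes D :: "('r, nat) struct"
  assumes "is_local ar \<psi>" "is_structure ar D"
    and comp: "\<forall>R. \<forall>t\<in>interp D R. set t \<subseteq> U \<or> set t \<inter> U = {}"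
    and U: "U \<subseteq> univ D" and a: "a \<in> U"
  shows "sat (induced D U) (\<lambda>_. a) \<psi> \<longleftrightarrow> sat D (\<lambda>_. a) \<psi>"
proof -
  obtain r xs where *: "\<And>(A :: ('r, nat) struct) v. is_structure ar A \<Longrightarrow> v ` set xs \<subseteq> univ A \<Longrightarrow>
      sat A v \<psi> \<longleftrightarrow> sat (nbhd A r (map v xs)) v \<psi>"
    using assms(1) unfolding is_local_def r_local_def by blast
  have "is_structure ar (induced D U)"
    by (rule is_structure_induced) (use assms in auto)
  moreover have "nbhd (induced D U) r (map (\<lambda>_. a) xs) = nbhd D r (map (\<lambda>_. a) xs)"
    by (rule nbhd_induced_component[OF comp U]) (use a in auto)
  moreover have "(\<lambda>_. a) ` set xs \<subseteq> univ D" "(\<lambda>_. a) ` set xs \<subseteq> univ (induced D U)"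
    using a U by (auto simp: induced_def)
  ultimately show ?thesis
    using *[of D "\<lambda>_. a"] *[of "induced D U" "\<lambda>_. a"] assms(2) by simp
qed

(* The graph 0 -> 1 -> 2 <- 4 -> 5 <- 7 <- 6 with 3 -> 4, and a disjoint path 9 -> 10 -> 11. *)
definition D :: "(sigma, nat) struct" where
  "D = \<lparr>univ = {0, 1, 2, 3, 4, 5, 6, 7, 9, 10, 11},
     interp = case_sigma
       {[0, 1], [1, 2], [3, 4], [4, 2], [4, 5], [6, 7], [7, 5], [9, 10], [10, 11]}
       {[2], [5], [11]} {}\<rparr>"

text \<open>In \<open>A0\<close> the formula \<open>phi\<close> separates 0 from 3. In
  \<open>D\<close> it holds at both, because the orange vertex 11 is reached from neither.\<close>

definition A0 :: "(sigma, nat) struct" where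
  "A0 = induced D {0, 1, 2, 3, 4, 5, 6, 7}"

lemma is_structure_D: "is_structure sigma_ar D"
proof -
  have "interp D R \<subseteq> {t. length t = sigma_ar R \<and> set t \<subseteq> univ D}" for R
    by (cases R) (auto simp: D_def)
  then show ?thesis by (auto simp: is_structure_def D_def)
qed

lemma is_structure_A0: "is_structure sigma_ar A0"
  unfolding A0_def by (rule is_structure_induced[OF is_structure_D]) (auto simp: D_def)

lemma is_local_A0_D:
  assumes "is_local sigma_ar \<psi>" "a \<in> univ A0"
  shows "sat A0 (\<lambda>_. a) \<psi> \<longleftrightarrow> sat D (\<lambda>_. a) \<psi>"
  unfolding A0_def
proof (rule is_local_component[OF assms(1) is_structure_D])
  let ?U = "{0, 1, 2, 3, 4, 5, 6, 7} :: nat set"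
  have "\<forall>t\<in>interp D R. set t \<subseteq> ?U \<or> set t \<inter> ?U = {}" for R
    by (cases R) (simp_all add: D_def)
  then show "\<forall>R. \<forall>t\<in>interp D R. set t \<subseteq> ?U \<or> set t \<inter> ?U = {}" ..
qed (use assms(2) in \<open>simp_all add: D_def A0_def induced_def\<close>)

section \<open>The two-round game on \<open>D\<close> from 0 and 3\<close>

text \<open>Replaces the quantifiers over symbols and lists by finitely many atomic checks, which
  simplification can evaluate on a concrete structure.\<close>

lemma partial_iso_sigma:
  assumes "is_structure sigma_ar A" "is_structure sigma_ar B"
  shows "partial_iso A B p \<longleftrightarrow>
    (\<forall>q\<in>p. ([fst q] \<in> interp A Orange \<longleftrightarrow> [snd q] \<in> interp B Orange) \<and>
       ([fst q] \<in> interp A Blue \<longleftrightarrow> [snd q] \<in> interp B Blue) \<and>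
       (\<forall>q'\<in>p. (fst q = fst q' \<longleftrightarrow> snd q = snd q') \<and>
         ([fst q, fst q'] \<in> interp A E \<longleftrightarrow> [snd q, snd q'] \<in> interp B E)))"
    (is "?L \<longleftrightarrow> ?R")
proof
  assume L: ?L
  have rel: "map fst ts \<in> interp A R \<longleftrightarrow> map snd ts \<in> interp B R" if "set ts \<subseteq> p" for R ts
    using L that unfolding partial_iso_def by blast
  have "\<forall>q\<in>p. \<forall>q'\<in>p. fst q = fst q' \<longleftrightarrow> snd q = snd q'"
    using L unfolding partial_iso_def by (elim conjE)
  moreover have "[fst q] \<in> interp A R \<longleftrightarrow> [snd q] \<in> interp B R" if "q \<in> p" for q R
    using rel[of "[q]"] that by simp
  moreover have "[fst q, fst q'] \<in> interp A R \<longleftrightarrow> [snd q, snd q'] \<in> interp B R"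
    if "q \<in> p" "q' \<in> p" for q q' R
    using rel[of "[q, q']"] that by simp
  ultimately show ?R by simp
next
  assume R: ?R
  have "map fst ts \<in> interp A S \<longleftrightarrow> map snd ts \<in> interp B S" if ts: "set ts \<subseteq> p" for S ts
  proof (cases "length ts = sigma_ar S")
    case True
    show ?thesis
    proof (cases S)
      case E
      with True obtain q q' where "ts = [q, q']"
        by (auto simp: length_Suc_conv numeral_2_eq_2)
      with R ts E show ?thesis by simp
    next
      case Orange
      with True obtain q where "ts = [q]" by (auto simp: length_Suc_conv)
      with R ts Orange show ?thesis by simp
    next
      case Blue
      with True obtain q where "ts = [q]" by (auto simp: length_Suc_conv)
      with R ts Blue show ?thesis by simp
    qed
  next
    \<comment> \<open>A list of the wrong length belongs to neither interpretation.\<close>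
    case False
    then have "length (map fst ts) \<noteq> sigma_ar S" "length (map snd ts) \<noteq> sigma_ar S" by auto
    with assms show ?thesis unfolding is_structure_def by blast
  qed
  with R show ?L unfolding partial_iso_def by simp
qed

text \<open>The pairs are replies to the first move. On the left 3, 4, 5 are far from 0 or unreached
  from it, and are answered on the path 9, 10, 11; on the right 0 and 1 are answered by 9 and 10.
  The left vertex 2 can match both 2 and 5, since each ends a path of length 2 from 3. For this each
  also needs an edge from a vertex that is not a successor of the start: 4 for the left 2, 1 for the
  right 2, and 7 for the right 5.\<close>

lemma back_forth_1_D:
  assumes "(y, y') \<in> {(0, 3), (1, 4), (2, 5), (2, 2), (3, 9), (4, 10), (5, 11), (9, 0), (10, 1),
    (6, 6), (7, 7), (9, 9), (10, 10), (11, 11)}"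
  shows "back_forth (Suc 0) D D {(y, y'), (0, 3)}"
  using assms
  by (elim insertE emptyE; simp add: partial_iso_sigma[OF is_structure_D is_structure_D];
      simp add: D_def)

lemma back_forth_2_D: "back_forth 2 D D {(0, 3)}"
proof -
  let ?p = "{(0, 3), (1, 4), (2, 5), (2, 2), (3, 9), (4, 10), (5, 11), (9, 0), (10, 1),
    (6, 6), (7, 7), (9, 9), (10, 10), (11, 11)} :: (nat \<times> nat) set"
  have "partial_iso D D {(0, 3)}"
    by (simp add: partial_iso_sigma[OF is_structure_D is_structure_D]; simp add: D_def)
  \<comment> \<open>The table has a reply to every first move on either side.\<close>
  moreover have "\<forall>a\<in>univ D. \<exists>b\<in>univ D. (a, b) \<in> ?p"
    and "\<forall>b\<in>univ D. \<exists>a\<in>univ D. (a, b) \<in> ?p"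
    by (simp_all add: D_def)
  ultimately show ?thesis
    using back_forth_1_D unfolding numeral_2_eq_2 back_forth.simps(2)[of "Suc 0"] by meson
qed

section \<open>Boolean combinations and non-equivalence\<close>

lemma A0_indistinguishable:
  assumes "bool_comb (\<lambda>\<psi>. (is_local sigma_ar \<psi> \<and> qrank \<psi> \<le> 2) \<or>
    basic_local_sentence sigma_ar \<psi>) \<phi>"
  shows "sat A0 (\<lambda>_. 0) \<phi> \<longleftrightarrow> sat A0 (\<lambda>_. 3) \<phi>"
  using assms
proof induction
  case (base \<phi>)
  then consider "is_local sigma_ar \<phi>" "qrank \<phi> \<le> 2" | "basic_local_sentence sigma_ar \<phi>"
    by blast
  then show ?case
  proof cases
    case 1
    \<comment> \<open>The game is won on \<open>D\<close>, not on \<open>A0\<close>; locality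
      carries the result back at both points.\<close>
    have "sat D (\<lambda>_. 0) \<phi> \<longleftrightarrow> sat D (\<lambda>_. 3) \<phi>"
      by (rule back_forth_sat[OF back_forth_2_D 1(2)]) simp
    moreover have "0 \<in> univ A0" "3 \<in> univ A0"
      by (auto simp: A0_def induced_def)
    ultimately show ?thesis
      using is_local_A0_D[OF 1(1)] by blast
  next
    case 2
    \<comment> \<open>There are no free variables, so the two assignments agree vacuously.\<close>
    then show ?thesis
      by (intro sat_cong) (simp add: fv_basic_local_sentence)
  qed
qed auto

theorem claim19:
  fixes x y z :: nat
  assumes "distinct [x, y, z]"
  shows "\<not> (\<exists>\<phi>'. fv \<phi>' \<subseteq> {x} \<and>
           bool_comb (\<lambda>\<psi>. (is_local sigma_ar \<psi> \<and> qrank \<psi> \<le> 2) \<or> basic_local_sentence sigma_ar \<psi>) \<phi>' \<and>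
           equivalent sigma_ar (phi x y z) \<phi>')"
proof
  assume "\<exists>\<phi>'. fv \<phi>' \<subseteq> {x} \<and>
    bool_comb (\<lambda>\<psi>. (is_local sigma_ar \<psi> \<and> qrank \<psi> \<le> 2) \<or> basic_local_sentence sigma_ar \<psi>) \<phi>' \<and>
    equivalent sigma_ar (phi x y z) \<phi>'"
  then obtain \<phi>' where comb: "bool_comb (\<lambda>\<psi>. (is_local sigma_ar \<psi> \<and> qrank \<psi> \<le> 2) \<or>
      basic_local_sentence sigma_ar \<psi>) \<phi>'"
    and equiv: "equivalent sigma_ar (phi x y z) \<phi>'"
    by blast
  have "sat A0 (\<lambda>_. a) (phi x y z) \<longleftrightarrow> sat A0 (\<lambda>_. a) \<phi>'" if "a \<in> univ A0" for a
  proof -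
    have "(\<lambda>_. a) ` (fv (phi x y z) \<union> fv \<phi>') \<subseteq> univ A0"
      using that by auto
    with equiv is_structure_A0 show ?thesis
      unfolding equivalent_def by blast
  qed
  moreover have "0 \<in> univ A0" "3 \<in> univ A0"
    by (auto simp: A0_def induced_def)
  ultimately have "sat A0 (\<lambda>_. 0) (phi x y z) \<longleftrightarrow> sat A0 (\<lambda>_. 3) (phi x y z)"
    using A0_indistinguishable[OF comb] by blast
  \<comment> \<open>The witness is 5: it is orange, no path of length 2 leads to it from 0, and
    nothing is blue.\<close>
  moreover have "sat A0 (\<lambda>_. 0) (phi x y z)"
    using assms by (auto simp: phi_def A0_def induced_def D_def)
  \<comment> \<open>The orange vertices of \<open>A0\<close> are 2 and 5, and 4 is a midpoint from 3
    to each of them.\<close>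
  moreover have "\<not> sat A0 (\<lambda>_. 3) (phi x y z)"
    using assms by (auto simp: phi_def A0_def induced_def D_def)
  ultimately show False by blast
qed

end
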